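(* Let $q\ge5$ be an integer. In the hyperbolic Pascal triangle linked to $\{4,q\}$, for $n\ge1$ let $\hat a_n$, $\hat b_n$ and $\hat s_n$ denote the sum of the labels of the type $A$ elements, of the type $B$ elements, and of all elements of row $n$, respectively. Then each of the three sequences $\{\hat a_n\}$, $\{\hat b_n\}$, $\{\hat s_n\}$ satisfies the ternary homogeneous recurrence relation $$x_n=qx_{n-1}-(q+1)x_{n-2}+2x_{n-3}\qquad(n\ge4),$$ with initial values $$\hat a_1=0,\;\hat a_2=2,\;\hat a_3=6,\qquad \hat b_1=0,\;\hat b_2=0,\;\hat b_3=2(q-4),\qquad \hat s_1=2,\;\hat s_2=4,\;\hat s_3=2q.$$ Moreover, with $$D=q^2-2q-7,\qquad \hat\alpha_q=\frac{(q-1)+\sqrt D}{2},\qquad \hat\beta_q=\frac{(q-1)-\sqrt D}{2},$$ the following formulae hold for all $n\ge1$: $$\hat a_n=\left(\frac{1-q}{2}+\frac{q^2-2q-3}{2(q^2-2q-7)}\sqrt D\right)\hat\alpha_q^n+\left(\frac{1-q}{2}-\frac{q^2-2q-3}{2(q^2-2q-7)}\sqrt D\right)\hat\beta_q^n+2,$$ $$\hat b_n=\left(\frac{q-2}{2}-\frac{q^2-3q-2}{2(q^2-2q-7)}\sqrt D\right)\hat\alpha_q^n+\left(\frac{q-2}{2}+\frac{q^2-3q-2}{2(q^2-2q-7)}\sqrt D\right)\hat\beta_q^n-2,$$ $$\hat s_n=\left(-\frac12+\frac{q-1}{2(q^2-2q-7)}\sqrt D\right)\hat\alpha_q^n+\left(-\frac12-\frac{q-1}{2(q^2-2q-7)}\sqrt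 D\right)\hat\beta_q^n+2.$$
   Context: The hyperbolic Pascal triangle linked to $\{4,q\}$ ($q\ge5$) is built on an infinite graph ${\mathcal I}_{4,q}$ (cut out of the regular hyperbolic mosaic with Schläfli symbol $\{4,q\}$), whose vertices are arranged in rows $0,1,2,\dots$, each row ordered from left to right, and whose edges join only vertices of consecutive rows. It is constructed as follows. Row $0$ consists of a single vertex $V_0$. Row $1$ consists of two vertices, both joined to $V_0$. For every $j\ge1$ the leftmost and rightmost vertices of row $j$ are called wingers; every other vertex has type $A$ or type $B$. Given row $j\ge 1$, row $j+1$ is obtained by drawing from each vertex of row $j$, in left-to-right order, downward edges: $2$ from a winger, $q-2$ from a vertex of type $A$, $q-1$ from a vertex of type $B$. For any two neighbouring vertices of row $j$, the last downward edge of the left one and the first downward edge of the right one end in one common vertex of row $j+1$, which has type $A$. Each of the remaining downward edges ends in its own separate vertex of row $j+1$; among these, the end of the first edge of the leftmost vertex and the end of the last edge of the rightmost vertex are the wingers of row $j+1$, and all the others have type $B$. The left-to-right order of row $j+1$ is the order of the edges. Wingers are not counted as type $A$ or type $B$ here. Each vertex is labelled by the number of distinct shortest paths from $V_0$ to it; equivalently, $V_0$ has label $1$ and the label of any other vertex is the sum of the labels of its (one or two) neighbours in the previous row. The labelled graph is the hyperbolic Pascal triangle; its elements are the labelled vertices. *)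

theory Defs
  imports Complex_Main "Graph_Theory.Graph_Theory"
begin

text \<open>
  Row \<open>n\<close> is represented by the list of the types of its vertices from left to right; the vertices
  of the graph are the pairs \<open>(n, i)\<close> with \<open>i\<close> a (zero-based) position in row \<open>n\<close>.
  The single vertex of row 0 has a type \<open>Apex\<close> of its own. It has two downward edges, so that the
  general step from one row to the next also yields row 1: two wingers, both joined to \<open>(0, 0)\<close>.
\<close>

datatype vertex_type = Apex | Winger | TypeA | TypeB

fun down_degree :: "nat \<Rightarrow> vertex_type \<Rightarrow> nat" where
  "down_degree q Apex = 2"
| "down_degree q Winger = 2"
| "down_degree q TypeA = q - 2"
| "down_degree q TypeB = q - 1"

text \<open>
  The row below a given row without its two wingers: the edges of a vertex other than its first and
  last one end in separate vertices of type B, and the last edge of a vertex shares its end, which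
  has type A, with the first edge of the right neighbour.
\<close>

fun inner_row :: "nat \<Rightarrow> vertex_type list \<Rightarrow> vertex_type list" where
  "inner_row q [] = []"
| "inner_row q [t] = replicate (down_degree q t - 2) TypeB"
| "inner_row q (t # u # ts) =
     replicate (down_degree q t - 2) TypeB @ [TypeA] @ inner_row q (u # ts)"

primrec row :: "nat \<Rightarrow> nat \<Rightarrow> vertex_type list" where
  "row q 0 = [Apex]"
| "row q (Suc n) = [Winger] @ inner_row q (row q n) @ [Winger]"

text \<open>
  Position, in the next row, of the end of the first downward edge of the \<open>i\<close>-th vertex. Each vertex
  to the left advances the position by its number of downward edges minus one, because its last edge
  shares its end with the first edge of the next vertex. The \<open>k\<close>-th downward edge (counted from 0)
  then ends \<open>k\<close> positions further to the right.
\<close>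

definition first_end :: "nat \<Rightarrow> vertex_type list \<Rightarrow> nat \<Rightarrow> nat" where
  "first_end q ts i = (\<Sum>k<i. down_degree q (ts ! k) - 1)"

definition down_arcs :: "nat \<Rightarrow> ((nat \<times> nat) \<times> (nat \<times> nat)) set" where
  "down_arcs q = {((n, i), (Suc n, first_end q (row q n) i + k)) | n i k.
     i < length (row q n) \<and> k < down_degree q (row q n ! i)}"

text \<open>The (undirected) graph, as a symmetric digraph.\<close>

definition pascal_graph :: "nat \<Rightarrow> (nat \<times> nat) pair_pre_digraph" where
  "pascal_graph q = \<lparr> pverts = {(n, i). i < length (row q n)},
                      parcs = down_arcs q \<union> (down_arcs q)\<inverse> \<rparr>"

definition shortest_path :: "('a, 'b) pre_digraph \<Rightarrow> 'a \<Rightarrow> 'b awalk \<Rightarrow> 'a \<Rightarrow> bool" where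
  "shortest_path G u p v \<longleftrightarrow> is_arg_min length (\<lambda>p. pre_digraph.apath G u p v) p"

definition label :: "nat \<Rightarrow> nat \<times> nat \<Rightarrow> nat" where
  "label q v = card {p. shortest_path (with_proj (pascal_graph q)) (0, 0) p v}"

definition a_hat :: "nat \<Rightarrow> nat \<Rightarrow> real" where
  "a_hat q n = (\<Sum>i | i < length (row q n) \<and> row q n ! i = TypeA. real (label q (n, i)))"

definition b_hat :: "nat \<Rightarrow> nat \<Rightarrow> real" where
  "b_hat q n = (\<Sum>i | i < length (row q n) \<and> row q n ! i = TypeB. real (label q (n, i)))"

definition s_hat :: "nat \<Rightarrow> nat \<Rightarrow> real" where
  "s_hat q n = (\<Sum>i<length (row q n). real (label q (n, i)))"

text \<open>
  Consistency of the encoding: shared ends have type A, and all arcs lie within the vertex set.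
\<close>

lemma row_1: "row q 1 = [Winger, Winger]"
  by simp

lemma first_end_Suc:
  "first_end q ts (Suc i) = first_end q ts i + (down_degree q (ts ! i) - 1)"
  by (simp add: first_end_def)

lemma first_end_Cons_Suc:
  "first_end q (t # ts) (Suc i) = (down_degree q t - 1) + first_end q ts i"
  unfolding first_end_def by (subst sum.lessThan_Suc_shift) simp

lemma down_degree_ge_2: "q \<ge> 5 \<Longrightarrow> 2 \<le> down_degree q t"
  by (cases t) auto

lemma length_inner_row:
  assumes "q \<ge> 5" "ts \<noteq> []"
  shows "Suc (length (inner_row q ts)) = first_end q ts (length ts)"
  using assms(2,1)
proof (induction q ts rule: inner_row.induct)
  case (2 q t)
  then show ?case
    using down_degree_ge_2[of q t] by (simp add: first_end_def)
next
  case (3 q t u ts)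
  then show ?case
    using down_degree_ge_2[of q t] by (simp add: first_end_Cons_Suc)
qed simp

lemma row_nonempty: "row q n \<noteq> []"
  by (cases n) simp_all

lemma shared_end_TypeA:
  assumes "q \<ge> 5" "Suc i < length (row q n)"
  shows "row q (Suc n) ! first_end q (row q n) (Suc i) = TypeA"
proof -
  have "Suc i < length ts \<Longrightarrow>
      \<exists>m. first_end q ts (Suc i) = Suc m \<and> m < length (inner_row q ts) \<and>
          inner_row q ts ! m = TypeA" for ts
    using assms(1)
  proof (induction q ts arbitrary: i rule: inner_row.induct)
    case (3 q t u ts)
    have d: "2 \<le> down_degree q t"
      using down_degree_ge_2 3 by blast
    show ?case
    proof (cases i)
      case 0
      have "first_end q (t # u # ts) (Suc i) = Suc (down_degree q t - 2)"
        using d 0 by (simp add: first_end_def)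
      then show ?thesis
        by (simp add: nth_append)
    next
      case (Suc j)
      then obtain m where m: "first_end q (u # ts) (Suc j) = Suc m"
          "m < length (inner_row q (u # ts))" "inner_row q (u # ts) ! m = TypeA"
        using 3 by auto
      have "first_end q (t # u # ts) (Suc i) = Suc ((down_degree q t - 2) + Suc m)"
        using d m(1) Suc by (simp add: first_end_Cons_Suc)
      then show ?thesis
        using m by (intro exI[of _ "(down_degree q t - 2) + Suc m"]) (simp add: nth_append)
    qed
  qed simp_all
  from this[OF assms(2)] show ?thesis
    by (auto simp: nth_append)
qed

lemma pascal_graph_wf:
  assumes "q \<ge> 5"
  shows "pair_bidirected_digraph (pascal_graph q)"
proof -
  have dec: "first_end q ts i + k < Suc (Suc (length (inner_row q ts)))"
    if "i < length ts" "k < down_degree q (ts ! i)" for ts i k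
  proof -
    have "first_end q ts (Suc i) \<le> first_end q ts (length ts)"
      unfolding first_end_def using that(1) by (intro sum_mono2) auto
    moreover have "Suc (length (inner_row q ts)) = first_end q ts (length ts)"
      using that(1) assms by (intro length_inner_row) auto
    ultimately show ?thesis
      using that(2) by (simp add: first_end_Suc)
  qed
  have arcs: "i < length (row q n) \<and> m = Suc n \<and> j < length (row q m)"
    if "((n, i), (m, j)) \<in> down_arcs q" for n i m j
    using that dec[of i "row q n"] by (auto simp: down_arcs_def)
  show ?thesis
    by unfold_locales
      (auto simp: pascal_graph_def symmetric_def arcs_ends_def arc_to_ends_def dest: arcs intro!: symI)
qed

end

theory Submission
  imports Defs
begin

text \<open>
  An edge of the graph joins consecutive rows, so a walk from \<open>(0, 0)\<close> to row \<open>n\<close> has at least \<open>n\<close>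
  arcs, and one with exactly \<open>n\<close> arcs descends at every step. Every vertex below the apex has a
  parent, hence such descending walks exist and they are the shortest paths. Splitting them by
  their last arc shows that a label is the sum of the labels of the parents (\<open>label_Suc\<close>); this is
  carried out for digraphs with a rank function in the locale \<open>ranked_digraph\<close>.

  Read the other way round, each vertex passes its label to every one of its children. The sum of
  the labels of the vertices of type \<open>t\<close> in row \<open>n + 1\<close> is therefore the sum of the labels in row
  \<open>n\<close>, each multiplied by the number of children of type \<open>t\<close>. For \<open>n \<ge> 1\<close> that number depends
  only on the type of the parent: a winger has one child that is a winger and one of type A, and any
  other vertex has its first and last child of type A and all the others of type B
  (\<open>card_children\<close>). The two wingers keep label 1, and with \<open>a\<close> and \<open>b\<close> the sums for types A and B,
  \<open>a' = 2 a + 2 b + 2\<close> and \<open>b' = (q - 4) a + (q - 3) b\<close> (\<open>a_hat_Suc\<close>, \<open>b_hat_Suc\<close>), while the sum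
  of the whole row is \<open>a + b + 2\<close>.

  The matrix of this system has trace \<open>q - 1\<close> and determinant \<open>2 (q - 3) - 2 (q - 4) = 2\<close>, so its
  eigenvalues are the roots \<open>\<alpha>\<close>, \<open>\<beta>\<close> of \<open>x\<^sup>2 - (q - 1) x + 2\<close>, whose discriminant is \<open>D\<close>. The constant
  vector \<open>(2, -2)\<close> is a fixed point, which accounts for the terms \<open>2\<close> and \<open>-2\<close> of the closed forms and
  for the factor \<open>x - 1\<close> in the characteristic polynomial
  \<open>(x - 1) (x\<^sup>2 - (q - 1) x + 2) = x\<^sup>3 - q x\<^sup>2 + (q + 1) x - 2\<close> of the ternary recurrence.
\<close>

section \<open>Counting shortest paths in ranked digraphs\<close>

text \<open>
  The rank rises by at most one along an arc but may also drop, as it does on the arcs that lead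
  back to the root in a symmetric digraph. As every other vertex is entered from the preceding rank,
  the rank is the distance from the root; finiteness is what allows shortest paths to be counted by
  their last arc.
\<close>

locale ranked_digraph = wf_digraph G for G (structure) +
  fixes root :: 'a and rank :: "'a \<Rightarrow> nat"
  assumes root_in_verts: "root \<in> verts G"
    and rank_root: "v \<in> verts G \<Longrightarrow> rank v = 0 \<longleftrightarrow> v = root"
    and rank_head: "e \<in> arcs G \<Longrightarrow> rank (head G e) \<le> Suc (rank (tail G e))"
    and ex_up_arc: "v \<in> verts G \<Longrightarrow> 0 < rank v \<Longrightarrow>
          \<exists>e\<in>arcs G. head G e = v \<and> Suc (rank (tail G e)) = rank v"
    and finite_up_arcs: "finite {e \<in> arcs G. head G e = v \<and> Suc (rank (tail G e)) = rank v}"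
begin

definition up_arcs :: "'a \<Rightarrow> 'b set" where
  "up_arcs v = {e \<in> arcs G. head G e = v \<and> Suc (rank (tail G e)) = rank v}"

definition direct_walks :: "'a \<Rightarrow> 'b list set" where
  "direct_walks v = {p. awalk root p v \<and> length p = rank v}"

lemma awalk_snoc_iff:
  "awalk u (p @ [e]) v \<longleftrightarrow> e \<in> arcs G \<and> head G e = v \<and> awalk u p (tail G e)"
proof
  assume "awalk u (p @ [e]) v"
  then show "e \<in> arcs G \<and> head G e = v \<and> awalk u p (tail G e)"
    by (auto simp: awalk_simps)
next
  assume *: "e \<in> arcs G \<and> head G e = v \<and> awalk u p (tail G e)"
  then have "awlast u p = tail G e"
    by auto
  with * show "awalk u (p @ [e]) v"
    by (auto simp: awalk_simps)
qed

lemma rank_le_length: "awalk root p v \<Longrightarrow> rank v \<le> length p"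
proof (induction p arbitrary: v rule: rev_induct)
  case Nil
  then show ?case
    using rank_root[OF root_in_verts] by (simp add: awalk_Nil_iff)
next
  case (snoc e p)
  then have "e \<in> arcs G" "head G e = v" "rank (tail G e) \<le> length p"
    by (simp_all add: awalk_snoc_iff del: awalk_append_iff)
  with rank_head[of e] show ?case
    by simp
qed

lemma direct_walks_root: "direct_walks root = {[]}"
  using rank_root[OF root_in_verts] root_in_verts by (auto simp: direct_walks_def awalk_Nil_iff)

lemma direct_walks_step:
  assumes "0 < rank v"
  shows "direct_walks v = (\<Union>e\<in>up_arcs v. (\<lambda>p. p @ [e]) ` direct_walks (tail G e))"
proof (intro equalityI subsetI)
  fix p assume p: "p \<in> direct_walks v"
  with assms have "p \<noteq> []"
    by (auto simp: direct_walks_def)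
  then obtain p' e where [simp]: "p = p' @ [e]"
    by (metis append_butlast_last_id)
  have e: "e \<in> arcs G" "head G e = v" "awalk root p' (tail G e)" "Suc (length p') = rank v"
    using p by (simp_all add: direct_walks_def awalk_snoc_iff del: awalk_append_iff)
  (* The walk without its last arc cannot be shorter than the rank of its end,
     and the last arc gains at most 1. *)
  have "rank (tail G e) = length p'"
    using rank_le_length[OF e(3)] rank_head[OF e(1)] e(2,4) by simp
  with e show "p \<in> (\<Union>e\<in>up_arcs v. (\<lambda>p. p @ [e]) ` direct_walks (tail G e))"
    by (auto simp: up_arcs_def direct_walks_def)
next
  fix p assume "p \<in> (\<Union>e\<in>up_arcs v. (\<lambda>p. p @ [e]) ` direct_walks (tail G e))"
  then show "p \<in> direct_walks v"
    by (auto simp: up_arcs_def direct_walks_def awalk_snoc_iff simp del: awalk_append_iff)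
qed

lemma finite_direct_walks: "v \<in> verts G \<Longrightarrow> finite (direct_walks v)"
proof (induction "rank v" arbitrary: v)
  case 0
  then show ?case
    using rank_root[of v] by (simp add: direct_walks_root)
next
  case (Suc n)
  then have "finite (direct_walks (tail G e))" if "e \<in> up_arcs v" for e
    using that by (auto simp: up_arcs_def)
  moreover have "finite (up_arcs v)"
    unfolding up_arcs_def by (rule finite_up_arcs)
  ultimately show ?case
    using Suc.hyps(2) by (simp add: direct_walks_step)
qed

text \<open>The union over the last arc is disjoint, and appending a fixed arc is injective.\<close>

lemma card_direct_walks_step:
  assumes "0 < rank v"
  shows "card (direct_walks v) = (\<Sum>e\<in>up_arcs v. card (direct_walks (tail G e)))"
proof -
  have "card (direct_walks v) = (\<Sum>e\<in>up_arcs v. card ((\<lambda>p. p @ [e]) ` direct_walks (tail G e)))"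
    unfolding direct_walks_step[OF assms]
    by (intro card_UN_disjoint)
      (auto simp: up_arcs_def finite_up_arcs intro!: finite_imageI finite_direct_walks)
  also have "\<dots> = (\<Sum>e\<in>up_arcs v. card (direct_walks (tail G e)))"
    by (intro sum.cong card_image refl) (simp add: inj_on_def)
  finally show ?thesis .
qed

lemma direct_walks_nonempty: "v \<in> verts G \<Longrightarrow> direct_walks v \<noteq> {}"
proof (induction "rank v" arbitrary: v)
  case 0
  then show ?case
    using rank_root[of v] by (simp add: direct_walks_root)
next
  case (Suc n)
  then obtain e where "e \<in> up_arcs v"
    using ex_up_arc[of v] by (auto simp: up_arcs_def)
  moreover have "direct_walks (tail G e) \<noteq> {}"
    using Suc calculation by (auto simp: up_arcs_def)
  ultimately show ?case
    using Suc.hyps(2) by (auto simp: direct_walks_step)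
qed

text \<open>
  The ranks along such a walk increase by one at each step, so that its vertices are distinct: this
  is what makes it a path.
\<close>

lemma map_rank_awalk_verts:
  "p \<in> direct_walks v \<Longrightarrow> map rank (awalk_verts root p) = [0..<Suc (rank v)]"
proof (induction p arbitrary: v rule: rev_induct)
  case Nil
  then show ?case
    using rank_root[OF root_in_verts] by (simp add: direct_walks_def awalk_Nil_iff)
next
  case (snoc e p)
  then have "0 < rank v"
    by (simp add: direct_walks_def)
  then have e: "e \<in> up_arcs v" "p \<in> direct_walks (tail G e)"
    using snoc.prems by (auto simp: direct_walks_step)
  then have "awalk root p (tail G e)" "head G e = v" "Suc (rank (tail G e)) = rank v"
    by (auto simp: direct_walks_def up_arcs_def)
  moreover have "awalk root (p @ [e]) v"
    using snoc.prems by (simp add: direct_walks_def)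
  ultimately show ?case
    using snoc.IH[OF e(2)] by (simp add: awalk_verts_append del: awalk_append_iff)
qed

lemma shortest_path_iff_direct:
  assumes "v \<in> verts G"
  shows "shortest_path G root p v \<longleftrightarrow> p \<in> direct_walks v"
proof -
  have apath: "apath root p v" if "p \<in> direct_walks v" for p
    using map_rank_awalk_verts[OF that] that distinct_map[of rank "awalk_verts root p"]
    by (auto simp: apath_def direct_walks_def)
  have le: "rank v \<le> length p" if "apath root p v" for p
    using that rank_le_length by (auto simp: apath_def)
  obtain p0 where p0: "p0 \<in> direct_walks v"
    using direct_walks_nonempty[OF assms] by auto
  have len: "length p = rank v" if "p \<in> direct_walks v" for p
    using that by (simp add: direct_walks_def)
  show ?thesis
  proof
    assume "shortest_path G root p v"
    then have "apath root p v" "\<not> length p0 < length p"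
      using apath[OF p0] by (auto simp: shortest_path_def is_arg_min_def)
    then show "p \<in> direct_walks v"
      using le[of p] len[OF p0] by (auto simp: direct_walks_def apath_def)
  next
    assume "p \<in> direct_walks v"
    then show "shortest_path G root p v"
      using apath le len by (auto simp: shortest_path_def is_arg_min_def linorder_not_less)
  qed
qed

end

section \<open>Types of the children of a vertex\<close>

lemma first_end_length_row:
  assumes "q \<ge> 5"
  shows "Suc (first_end q (row q n) (length (row q n))) = length (row q (Suc n))"
  using length_inner_row[OF assms row_nonempty, of q n] by simp

lemma child_position_less:
  assumes "q \<ge> 5" "i < length (row q n)" "k < down_degree q (row q n ! i)"
  shows "first_end q (row q n) i + k < length (row q (Suc n))"
proof -
  have "first_end q (row q n) (Suc i) \<le> first_end q (row q n) (length (row q n))"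
    unfolding first_end_def using assms(2) by (intro sum_mono2) auto
  then show ?thesis
    using first_end_length_row[OF assms(1), of n] assms(3) by (simp add: first_end_Suc del: row.simps)
qed

text \<open>
  The blocks of children of consecutive vertices cover the next row, because each block begins where
  the previous one ends and the last one ends at the right border. A parent of position \<open>j\<close> is thus
  the rightmost vertex whose block begins no later than \<open>j\<close>.
\<close>

lemma ex_parent:
  assumes "q \<ge> 5" "j < length (row q (Suc n))"
  shows "\<exists>i k. i < length (row q n) \<and> k < down_degree q (row q n ! i) \<and>
           j = first_end q (row q n) i + k"
proof -
  let ?f = "first_end q (row q n)"
  let ?I = "{i. i < length (row q n) \<and> ?f i \<le> j}"
  define i where "i = Max ?I"
  have "0 \<in> ?I"
    using row_nonempty[of q n] by (simp add: first_end_def)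
  then have i: "i \<in> ?I"
    unfolding i_def by (intro Max_in) auto
  have d: "2 \<le> down_degree q (row q n ! i)"
    using down_degree_ge_2 assms(1) by blast
  have "j < ?f i + down_degree q (row q n ! i)"
  proof (cases "Suc i < length (row q n)")
    case True
    have "Suc i \<notin> ?I"
    proof
      assume "Suc i \<in> ?I"
      then have "Suc i \<le> i"
        unfolding i_def by (intro Max_ge) auto
      then show False by simp
    qed
    with True show ?thesis
      by (simp add: first_end_Suc)
  next
    case False
    with i have "Suc i = length (row q n)"
      by simp
    then have "Suc (?f (Suc i)) = length (row q (Suc n))"
      using first_end_length_row[OF assms(1), of n] by simp
    with assms(2) d show ?thesis
      by (simp add: first_end_Suc del: row.simps)
  qed
  with i show ?thesis
    by (intro exI[of _ i] exI[of _ "j - ?f i"]) auto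
qed

text \<open>
  The position is written as \<open>Suc m\<close> because \<open>inner_row\<close> lacks the left winger, which shifts its
  indices by one against those of the whole row.
\<close>

lemma inner_row_nth_TypeB:
  assumes "q \<ge> 5" "i < length ts" "0 < k" "Suc k < down_degree q (ts ! i)"
  shows "\<exists>m. first_end q ts i + k = Suc m \<and> m < length (inner_row q ts) \<and>
             inner_row q ts ! m = TypeB"
  using assms
proof (induction q ts arbitrary: i rule: inner_row.induct)
  case (2 q t)
  then show ?case
    by (intro exI[of _ "k - 1"]) (auto simp: first_end_def)
next
  case (3 q t u ts)
  have d: "2 \<le> down_degree q t"
    using down_degree_ge_2 3 by blast
  show ?case
  proof (cases i)
    case 0
    with 3 show ?thesis
      by (intro exI[of _ "k - 1"]) (auto simp: first_end_def nth_append)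
  next
    case (Suc j)
    then obtain m where m: "first_end q (u # ts) j + k = Suc m"
        "m < length (inner_row q (u # ts))" "inner_row q (u # ts) ! m = TypeB"
      using 3 by auto
    have "first_end q (t # u # ts) i + k = Suc ((down_degree q t - 2) + Suc m)"
      using d m(1) Suc by (simp add: first_end_Cons_Suc)
    then show ?thesis
      using m by (intro exI[of _ "(down_degree q t - 2) + Suc m"]) (simp add: nth_append)
  qed
qed simp

lemma child_type:
  assumes q: "q \<ge> 5" and i: "i < length (row q n)" and k: "k < down_degree q (row q n ! i)"
  shows "row q (Suc n) ! (first_end q (row q n) i + k) =
    (if k = 0 then if i = 0 then Winger else TypeA
     else if Suc k = down_degree q (row q n ! i)
       then if Suc i = length (row q n) then Winger else TypeA
     else TypeB)"
proof (cases "k = 0")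
  case True
  then show ?thesis
    using shared_end_TypeA[OF q, of "i - 1" n] i by (cases i) (simp_all add: first_end_def)
next
  case k0: False
  show ?thesis
  proof (cases "Suc k = down_degree q (row q n ! i)")
    case True
    then have pos: "first_end q (row q n) i + k = first_end q (row q n) (Suc i)"
      by (simp add: first_end_Suc flip: True)
    show ?thesis
    proof (cases "Suc i = length (row q n)")
      case last: True
      have "row q (Suc n) ! first_end q (row q n) (Suc i) = Winger"
        using length_inner_row[OF q row_nonempty, of q n, symmetric] last by (simp add: nth_append)
      with last k0 True show ?thesis
        unfolding pos by simp
    next
      case False
      with i k0 True show ?thesis
        unfolding pos using shared_end_TypeA[OF q, of i n] by simp
    qed
  next
    case False
    then obtain m where "first_end q (row q n) i + k = Suc m" "m < length (inner_row q (row q n))"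
        "inner_row q (row q n) ! m = TypeB"
      using inner_row_nth_TypeB[OF q i, of k] k k0 by auto
    with k0 False show ?thesis
      by (simp add: nth_append)
  qed
qed

lemma set_inner_row: "set (inner_row q ts) \<subseteq> {TypeA, TypeB}"
  by (induction q ts rule: inner_row.induct) auto

lemma nth_row_Suc_Winger_iff:
  assumes "i < length (row q (Suc n))"
  shows "row q (Suc n) ! i = Winger \<longleftrightarrow> i = 0 \<or> Suc i = length (row q (Suc n))"
proof -
  have "inner_row q (row q n) ! m \<noteq> Winger" if "m < length (inner_row q (row q n))" for m
    using set_inner_row[of q "row q n"] nth_mem[OF that] by auto
  with assms show ?thesis
    by (auto simp: nth_append nth_Cons split: nat.split if_splits)
qed

lemma set_row_Suc: "set (row q (Suc n)) \<subseteq> {Winger, TypeA, TypeB}"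
  using set_inner_row[of q "row q n"] by auto

lemma less_2_Collect:
  "{k::nat. k < 2 \<and> P k} = (if P 0 then {0} else {}) \<union> (if P 1 then {1} else {})"
proof -
  have "k < 2 \<longleftrightarrow> k = 0 \<or> k = 1" for k :: nat
    by auto
  then show ?thesis
    by (simp only: conj_disj_distribR Collect_disj_eq Collect_conv_if)
qed

text \<open>
  The second argument is the type of the parent, the third one that of the children. The apex falls
  under the default value 0: the table is meant for rows 1, 2, \<open>\<dots>\<close> only.
\<close>

fun num_children :: "nat \<Rightarrow> vertex_type \<Rightarrow> vertex_type \<Rightarrow> nat" where
  "num_children q Winger Winger = 1"
| "num_children q Winger TypeA = 1"
| "num_children q TypeA TypeA = 2"
| "num_children q TypeB TypeA = 2"
| "num_children q TypeA TypeB = q - 4"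
| "num_children q TypeB TypeB = q - 3"
| "num_children q _ _ = 0"

text \<open>
  From row 1 on the wingers are exactly the two border vertices. This turns the dependence of the
  type of a child on the position of the parent into a dependence on the type of the parent.
\<close>

lemma card_children:
  assumes q: "q \<ge> 5" and n: "n = Suc n'" and i: "i < length (row q n)"
  shows "card {k. k < down_degree q (row q n ! i) \<and>
                  row q (Suc n) ! (first_end q (row q n) i + k) = t} =
         num_children q (row q n ! i) t" (is "card ?C = _")
proof -
  define d where "d = down_degree q (row q n ! i)"
  define c where "c k = (if k = 0 then if i = 0 then Winger else TypeA
     else if Suc k = d then if Suc i = length (row q n) then Winger else TypeA
     else TypeB)" for k
  have C: "?C = {k. k < d \<and> c k = t}"
    using child_type[OF q i] by (simp add: d_def c_def del: row.simps cong: conj_cong)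
  have len: "2 \<le> length (row q n)"
    by (simp add: n)
  have wing: "row q n ! i = Winger \<longleftrightarrow> i = 0 \<or> Suc i = length (row q n)"
    using nth_row_Suc_Winger_iff[of i q n'] i by (simp add: n del: row.simps)
  have "row q n ! i \<in> {Winger, TypeA, TypeB}"
    using set_row_Suc[of q n'] nth_mem[OF i] unfolding n by (rule subsetD)
  then consider "row q n ! i = Winger" | "row q n ! i \<in> {TypeA, TypeB}"
    by auto
  then show ?thesis
  proof cases
    case 1
    then have d: "d = 2" and ends: "(i = 0) \<noteq> (Suc i = length (row q n))"
      using wing len by (auto simp: d_def)
    have "c 0 = Winger \<and> c 1 = TypeA \<or> c 0 = TypeA \<and> c 1 = Winger"
    proof (cases "i = 0")
      case True
      with ends have "Suc i \<noteq> length (row q n)"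
        by blast
      with True show ?thesis
        unfolding c_def d by simp
    next
      case False
      with ends have "Suc i = length (row q n)"
        by blast
      with False show ?thesis
        unfolding c_def d by simp
    qed
    then have "card {k. k < d \<and> c k = t} = num_children q Winger t"
      unfolding d less_2_Collect by (cases t) auto
    then show ?thesis
      by (simp only: C) (simp only: 1)
  next
    case 2
    then have d: "3 \<le> d" and ends: "i \<noteq> 0" "Suc i \<noteq> length (row q n)"
      using wing q by (auto simp: d_def)
    have c: "c k = (if k = 0 \<or> k = d - 1 then TypeA else TypeB)" for k
      using ends d unfolding c_def by auto
    have "{k. k < d \<and> c k = t} =
        (if t = TypeA then {0, d - 1} else if t = TypeB then {1..<d - 1} else {})"
      unfolding c using d by (cases t) auto
    then have "card {k. k < d \<and> c k = t} = (if t = TypeA then 2 else if t = TypeB then d - 2 else 0)"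
      using d by (simp add: numeral_2_eq_2)
    moreover have "num_children q (row q n ! i) t =
        (if t = TypeA then 2 else if t = TypeB then d - 2 else 0)"
      using 2 by (cases t) (auto simp: d_def)
    ultimately show ?thesis
      unfolding C by simp
  qed
qed

section \<open>Labels in the hyperbolic Pascal triangle\<close>

lemma down_arcs_level: "e \<in> down_arcs q \<Longrightarrow> fst (snd e) = Suc (fst (fst e))"
  by (auto simp: down_arcs_def)

lemma down_arcs_fst_in_pverts: "e \<in> down_arcs q \<Longrightarrow> fst e \<in> pverts (pascal_graph q)"
  by (auto simp: down_arcs_def pascal_graph_def)

lemma parcs_pascal_graph_level:
  "e \<in> parcs (pascal_graph q) \<Longrightarrow> fst (snd e) \<le> Suc (fst (fst e))"
  by (auto simp: pascal_graph_def dest: down_arcs_level)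

lemma down_arcs_iff:
  "e \<in> down_arcs q \<longleftrightarrow> e \<in> parcs (pascal_graph q) \<and> fst (snd e) = Suc (fst (fst e))"
  by (auto simp: pascal_graph_def dest: down_arcs_level)

lemma down_arcs_into:
  "{e \<in> down_arcs q. snd e = (Suc n, j)} =
   (\<lambda>(i, k). ((n, i), (Suc n, j))) `
     {(i, k). i < length (row q n) \<and> k < down_degree q (row q n ! i) \<and>
              first_end q (row q n) i + k = j}"
  by (force simp: down_arcs_def)

lemma ranked_pascal_graph:
  assumes q: "q \<ge> 5"
  shows "ranked_digraph (with_proj (pascal_graph q)) (0, 0) fst"
proof -
  interpret pair_bidirected_digraph "pascal_graph q"
    by (rule pascal_graph_wf[OF q])
  have up: "{e \<in> parcs (pascal_graph q). snd e = v \<and> Suc (fst (fst e)) = fst v}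
      = {e \<in> down_arcs q. snd e = v}" for v
    by (auto simp: down_arcs_iff)
  show ?thesis
  proof
    show "(0, 0) \<in> verts (with_proj (pascal_graph q))"
      by (simp add: pascal_graph_def)
    show "fst v = 0 \<longleftrightarrow> v = (0, 0)" if "v \<in> verts (with_proj (pascal_graph q))" for v
      using that by (auto simp: pascal_graph_def)
    show "fst (head (with_proj (pascal_graph q)) e) \<le> Suc (fst (tail (with_proj (pascal_graph q)) e))"
      if "e \<in> arcs (with_proj (pascal_graph q))" for e
      using that parcs_pascal_graph_level by simp
    show "\<exists>e\<in>arcs (with_proj (pascal_graph q)). head (with_proj (pascal_graph q)) e = v \<and>
        Suc (fst (tail (with_proj (pascal_graph q)) e)) = fst v"
      if v: "v \<in> verts (with_proj (pascal_graph q))" "0 < fst v" for v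
    proof -
      obtain n j where [simp]: "v = (Suc n, j)"
        using v(2) by (cases v) (auto simp: gr0_conv_Suc)
      have "j < length (row q (Suc n))"
        using v(1) by (simp add: pascal_graph_def)
      then obtain i k where ik: "i < length (row q n)" "k < down_degree q (row q n ! i)"
          "j = first_end q (row q n) i + k"
        using ex_parent[OF q] by blast
      then have "((n, i), v) \<in> parcs (pascal_graph q)"
        by (auto simp: pascal_graph_def down_arcs_def)
      then show ?thesis
        by force
    qed
    show "finite {e \<in> arcs (with_proj (pascal_graph q)). head (with_proj (pascal_graph q)) e = v \<and>
        Suc (fst (tail (with_proj (pascal_graph q)) e)) = fst v}" for v
    proof (cases v)
      case (Pair m j)
      show ?thesis
      proof (cases m)
        case 0
        then have "{e \<in> down_arcs q. snd e = v} = {}"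
          using Pair by (auto simp: down_arcs_def)
        then show ?thesis
          using up[of v] by (simp only: with_proj_simps finite.emptyI)
      next
        case (Suc n)
        have "finite {(i, k). i < length (row q n) \<and> k < down_degree q (row q n ! i) \<and>
              first_end q (row q n) i + k = j}"
          by (rule finite_subset[of _ "Sigma {..<length (row q n)} (\<lambda>i. {..<down_degree q (row q n ! i)})"])
            auto
        then show ?thesis
          using up[of v] Pair Suc down_arcs_into[of q n j] by simp
      qed
    qed
  qed
qed

lemma label_root:
  assumes "q \<ge> 5"
  shows "label q (0, 0) = 1"
proof -
  interpret ranked_digraph "with_proj (pascal_graph q)" "(0, 0)" fst
    by (rule ranked_pascal_graph[OF assms])
  show ?thesis
    unfolding label_def shortest_path_iff_direct[OF root_in_verts] by (simp add: direct_walks_root)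
qed

text \<open>
  The sum ranges over the pairs of a vertex and a downward edge that ends at position \<open>j\<close>, rather
  than over parents; this is the form in which the order of summation can be exchanged.
\<close>

lemma label_Suc:
  assumes q: "q \<ge> 5" and j: "j < length (row q (Suc n))"
  shows "label q (Suc n, j) =
    (\<Sum>(i, k) | i < length (row q n) \<and> k < down_degree q (row q n ! i) \<and>
                 first_end q (row q n) i + k = j. label q (n, i))"
proof -
  interpret ranked_digraph "with_proj (pascal_graph q)" "(0, 0)" fst
    by (rule ranked_pascal_graph[OF q])
  have label: "label q v = card (direct_walks v)" if "v \<in> pverts (pascal_graph q)" for v
    using that by (simp add: label_def shortest_path_iff_direct)
  have up: "up_arcs (Suc n, j) = {e \<in> down_arcs q. snd e = (Suc n, j)}"
    by (auto simp: up_arcs_def down_arcs_iff)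
  have "label q (Suc n, j) = card (direct_walks (Suc n, j))"
    using j by (intro label) (simp add: pascal_graph_def)
  also have "\<dots> = (\<Sum>e | e \<in> down_arcs q \<and> snd e = (Suc n, j). card (direct_walks (fst e)))"
    by (simp add: card_direct_walks_step up)
  also have "\<dots> = (\<Sum>e | e \<in> down_arcs q \<and> snd e = (Suc n, j). label q (fst e))"
    by (intro sum.cong) (auto simp: label down_arcs_fst_in_pverts)
  also have "\<dots> = (\<Sum>(i, k) | i < length (row q n) \<and> k < down_degree q (row q n ! i) \<and>
                 first_end q (row q n) i + k = j. label q (n, i))"
    unfolding down_arcs_into by (subst sum.reindex) (auto simp: inj_on_def case_prod_beta)
  finally show ?thesis .
qed

definition type_sum :: "nat \<Rightarrow> vertex_type \<Rightarrow> nat \<Rightarrow> real" where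
  "type_sum q t n = (\<Sum>i | i < length (row q n) \<and> row q n ! i = t. real (label q (n, i)))"

text \<open>
  Both sides sum the label of the upper end over the downward edges from row \<open>n\<close> whose lower end
  has type \<open>t\<close>: on the left grouped by the lower end, on the right by the upper end.
\<close>

lemma type_sum_Suc_vertices:
  assumes q: "q \<ge> 5"
  shows "type_sum q t (Suc n) =
    (\<Sum>i<length (row q n). real (card {k. k < down_degree q (row q n ! i) \<and>
        row q (Suc n) ! (first_end q (row q n) i + k) = t}) * real (label q (n, i)))"
proof -
  define C where "C i = {k. k < down_degree q (row q n ! i) \<and>
        row q (Suc n) ! (first_end q (row q n) i + k) = t}" for i
  define J where "J = {j. j < length (row q (Suc n)) \<and> row q (Suc n) ! j = t}"
  define E where "E = Sigma {..<length (row q n)} C"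
  define pos where "pos e = first_end q (row q n) (fst e) + snd e" for e
  have finC: "finite (C i)" for i
    by (simp add: C_def)
  have fin: "finite E" "finite J"
    using finC by (simp_all add: E_def J_def del: row.simps)
  have img: "pos ` E \<subseteq> J"
    using child_position_less[OF q]
    by (auto simp: E_def C_def J_def pos_def simp del: row.simps)
  have "type_sum q t (Suc n) = (\<Sum>j\<in>J. \<Sum>e | e \<in> E \<and> pos e = j. real (label q (n, fst e)))"
    unfolding type_sum_def J_def[symmetric]
  proof (rule sum.cong[OF refl])
    fix j assume "j \<in> J"
    then have j: "j < length (row q (Suc n))" "row q (Suc n) ! j = t"
      by (simp_all add: J_def del: row.simps)
    have "{(i, k). i < length (row q n) \<and> k < down_degree q (row q n ! i) \<and>
        first_end q (row q n) i + k = j} = {e. e \<in> E \<and> pos e = j}"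
      unfolding E_def C_def pos_def j(2)[symmetric] by (auto simp del: row.simps)
    with j(1) show "real (label q (Suc n, j)) = (\<Sum>e | e \<in> E \<and> pos e = j. real (label q (n, fst e)))"
      by (simp only: label_Suc[OF q] case_prod_beta of_nat_sum)
  qed
  also have "\<dots> = (\<Sum>e\<in>E. real (label q (n, fst e)))"
    by (rule sum.group[OF fin img])
  also have "\<dots> = (\<Sum>i<length (row q n). \<Sum>k\<in>C i. real (label q (n, i)))"
    unfolding E_def by (subst sum.Sigma) (simp_all add: finC case_prod_beta)
  also have "\<dots> = (\<Sum>i<length (row q n). real (card (C i)) * real (label q (n, i)))"
    by simp
  finally show ?thesis
    unfolding C_def .
qed

lemma sum_row_by_type:
  fixes f :: "vertex_type \<Rightarrow> real"
  shows "(\<Sum>i<length (row q (Suc n)). f (row q (Suc n) ! i) * real (label q (Suc n, i))) =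
    f Winger * type_sum q Winger (Suc n) + f TypeA * type_sum q TypeA (Suc n)
    + f TypeB * type_sum q TypeB (Suc n)"
proof -
  let ?r = "row q (Suc n)"
  have sub: "(\<lambda>i. ?r ! i) ` {..<length ?r} \<subseteq> {Winger, TypeA, TypeB}"
  proof (rule image_subsetI)
    fix i assume "i \<in> {..<length ?r}"
    then have "?r ! i \<in> set ?r"
      by (simp del: row.simps)
    then show "?r ! i \<in> {Winger, TypeA, TypeB}"
      using set_row_Suc by (rule rev_subsetD)
  qed
  have "(\<Sum>i<length ?r. f (?r ! i) * real (label q (Suc n, i))) =
      (\<Sum>t\<in>{Winger, TypeA, TypeB}. \<Sum>i | i \<in> {..<length ?r} \<and> ?r ! i = t.
         f (?r ! i) * real (label q (Suc n, i)))"
    by (rule sum.group[OF _ _ sub, symmetric]) auto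
  also have "\<dots> = (\<Sum>t\<in>{Winger, TypeA, TypeB}. f t * type_sum q t (Suc n))"
    unfolding type_sum_def sum_distrib_left by (intro sum.cong) (auto simp del: row.simps)
  finally show ?thesis
    by simp
qed

lemma type_sum_Suc:
  assumes "q \<ge> 5" "n \<ge> 1"
  shows "type_sum q t (Suc n) =
    real (num_children q Winger t) * type_sum q Winger n
    + real (num_children q TypeA t) * type_sum q TypeA n
    + real (num_children q TypeB t) * type_sum q TypeB n"
proof -
  obtain n' where n: "n = Suc n'"
    using assms(2) by (cases n) auto
  have "type_sum q t (Suc n) =
      (\<Sum>i<length (row q n). real (num_children q (row q n ! i) t) * real (label q (n, i)))"
    unfolding type_sum_Suc_vertices[OF assms(1)]
    by (intro sum.cong refl) (simp add: card_children[OF assms(1) n] del: row.simps)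
  then show ?thesis
    unfolding n by (simp only: sum_row_by_type[of "\<lambda>u. real (num_children q u t)"])
qed

lemma type_sum_1:
  assumes "q \<ge> 5"
  shows "type_sum q Winger 1 = 2" "type_sum q TypeA 1 = 0" "type_sum q TypeB 1 = 0"
proof -
  have "{k. k < (2::nat) \<and> [Winger, Winger] ! k = t} = (if t = Winger then {0, 1} else {})" for t
    unfolding less_2_Collect by auto
  then have "type_sum q t 1 = (if t = Winger then 2 else 0)" for t
    using type_sum_Suc_vertices[OF assms, of t 0] by (simp add: label_root[OF assms] first_end_def)
  then show "type_sum q Winger 1 = 2" "type_sum q TypeA 1 = 0" "type_sum q TypeB 1 = 0"
    by auto
qed

lemma type_sum_Winger:
  assumes "q \<ge> 5" "n \<ge> 1"
  shows "type_sum q Winger n = 2"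
  using assms(2)
proof (induction n rule: nat_induct_at_least)
  case base
  show ?case
    by (rule type_sum_1(1)[OF assms(1)])
next
  case (Suc n)
  then show ?case
    by (simp add: type_sum_Suc[OF assms(1)])
qed

section \<open>Recurrences and closed forms\<close>

lemma
  assumes "q \<ge> 5" "n \<ge> 1"
  shows a_hat_Suc: "a_hat q (Suc n) = 2 * a_hat q n + 2 * b_hat q n + 2"
    and b_hat_Suc: "b_hat q (Suc n) = (real q - 4) * a_hat q n + (real q - 3) * b_hat q n"
  using type_sum_Suc[OF assms, of TypeA] type_sum_Suc[OF assms, of TypeB] type_sum_Winger[OF assms]
    assms(1)
  by (simp_all add: a_hat_def b_hat_def type_sum_def[symmetric] of_nat_diff del: row.simps)

lemma s_hat_conv:
  assumes "q \<ge> 5" "n \<ge> 1"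
  shows "s_hat q n = a_hat q n + b_hat q n + 2"
proof -
  obtain n' where n: "n = Suc n'"
    using assms(2) by (cases n) auto
  show ?thesis
    using sum_row_by_type[of "\<lambda>_. 1" q n'] type_sum_Winger[OF assms]
    by (simp add: n s_hat_def a_hat_def b_hat_def type_sum_def[symmetric] del: row.simps)
qed

lemma a_hat_b_hat_1:
  assumes "q \<ge> 5"
  shows "a_hat q 1 = 0" "b_hat q 1 = 0"
  using type_sum_1[OF assms] by (simp_all add: a_hat_def b_hat_def type_sum_def)

text \<open>
  For a sign \<open>t\<close> and \<open>S = \<surd>D\<close>, the vector of the coefficients of the closed forms of \<open>a\<close> and \<open>b\<close> is an
  eigenvector, for the eigenvalue \<open>(Q - 1 + t S) / 2\<close>, of the matrix of the recurrence with \<open>Q = q\<close>.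
  Writing \<open>r\<close> for \<open>S / D\<close> keeps the identities polynomial.
\<close>

lemma coefficients_eigenvector:
  fixes Q S r t :: real
  assumes "t * t = 1" "S * S = Q * Q - 2 * Q - 7" "S * r = 1"
  defines "x \<equiv> (1 - Q) / 2 + t * (S + 4 * r) / 2"
    and "y \<equiv> (Q - 2) / 2 - t * (S + (5 - Q) * r) / 2"
    and "ev \<equiv> ((Q - 1) + t * S) / 2"
  shows "x * ev = 2 * x + 2 * y"
    and "y * ev = (Q - 4) * x + (Q - 3) * y"
proof -
  have "((1 - Q) + t * (S + 4 * r)) * ((Q - 1) + t * S) =
      4 * ((1 - Q) + t * (S + 4 * r)) + 4 * ((Q - 2) - t * (S + (5 - Q) * r))"
    "((Q - 2) - t * (S + (5 - Q) * r)) * ((Q - 1) + t * S) =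
      2 * (Q - 4) * ((1 - Q) + t * (S + 4 * r)) + 2 * (Q - 3) * ((Q - 2) - t * (S + (5 - Q) * r))"
    using assms(1-3) by algebra+
  then show "x * ev = 2 * x + 2 * y" "y * ev = (Q - 4) * x + (Q - 3) * y"
    unfolding x_def y_def ev_def by (simp_all add: field_simps)
qed

theorem theorem2:
  fixes q :: nat and D \<alpha> \<beta> :: real
  assumes q: "q \<ge> 5"
    and D: "D = real q ^ 2 - 2 * real q - 7"
    and \<alpha>: "\<alpha> = ((real q - 1) + sqrt D) / 2"
    and \<beta>: "\<beta> = ((real q - 1) - sqrt D) / 2"
  shows
    "(\<forall>x \<in> {a_hat q, b_hat q, s_hat q}. \<forall>n\<ge>4.
       x n = real q * x (n - 1) - (real q + 1) * x (n - 2) + 2 * x (n - 3)) \<and>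
     a_hat q 1 = 0 \<and> a_hat q 2 = 2 \<and> a_hat q 3 = 6 \<and>
     b_hat q 1 = 0 \<and> b_hat q 2 = 0 \<and> b_hat q 3 = 2 * (real q - 4) \<and>
     s_hat q 1 = 2 \<and> s_hat q 2 = 4 \<and> s_hat q 3 = 2 * real q \<and>
     (\<forall>n\<ge>1. a_hat q n =
         ((1 - real q) / 2
           + (real q ^ 2 - 2 * real q - 3) / (2 * (real q ^ 2 - 2 * real q - 7)) * sqrt D) * \<alpha> ^ n
       + ((1 - real q) / 2
           - (real q ^ 2 - 2 * real q - 3) / (2 * (real q ^ 2 - 2 * real q - 7)) * sqrt D) * \<beta> ^ n
       + 2) \<and>
     (\<forall>n\<ge>1. b_hat q n =
         ((real q - 2) / 2
           - (real q ^ 2 - 3 * real q - 2) / (2 * (real q ^ 2 - 2 * real q - 7)) * sqrt D) * \<alpha> ^ n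
       + ((real q - 2) / 2
           + (real q ^ 2 - 3 * real q - 2) / (2 * (real q ^ 2 - 2 * real q - 7)) * sqrt D) * \<beta> ^ n
       - 2) \<and>
     (\<forall>n\<ge>1. s_hat q n =
         (- (1 / 2) + (real q - 1) / (2 * (real q ^ 2 - 2 * real q - 7)) * sqrt D) * \<alpha> ^ n
       + (- (1 / 2) - (real q - 1) / (2 * (real q ^ 2 - 2 * real q - 7)) * sqrt D) * \<beta> ^ n
       + 2)"
proof -
  have a1: "a_hat q 1 = 0" and b1: "b_hat q 1 = 0"
    using a_hat_b_hat_1[OF q] by simp_all
  have step: "a_hat q (Suc n) = 2 * a_hat q n + 2 * b_hat q n + 2"
      "b_hat q (Suc n) = (real q - 4) * a_hat q n + (real q - 3) * b_hat q n" if "n \<ge> 1" for n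
    using a_hat_Suc[OF q that] b_hat_Suc[OF q that] .
  have s: "s_hat q n = a_hat q n + b_hat q n + 2" if "n \<ge> 1" for n
    by (rule s_hat_conv[OF q that])
  have two: "a_hat q 2 = 2" "b_hat q 2 = 0"
    using step[of 1] a1 b1 by (simp_all add: numeral_2_eq_2)
  have three: "a_hat q 3 = 6" "b_hat q 3 = 2 * (real q - 4)"
    using step[of 2] two by (simp_all add: numeral_3_eq_3)
  have rec: "x n = real q * x (n - 1) - (real q + 1) * x (n - 2) + 2 * x (n - 3)"
    if x: "x \<in> {a_hat q, b_hat q, s_hat q}" and n: "n \<ge> 4" for x n
  proof -
    obtain m where m: "n = Suc (Suc (Suc m))" "m \<ge> 1"
      using n by (intro that[of "n - 3"]) auto
    have "n - 1 = Suc (Suc m)" "n - 2 = Suc m" "n - 3 = m"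
      using m by auto
    with x m show ?thesis
      by (auto simp: s step algebra_simps)
  qed
  define r where "r = sqrt D / D"
  (* D is positive, so sqrt D is a genuine square root and D may be divided by. *)
  have "5 * real q \<le> real q * real q"
    using q by (intro mult_right_mono) auto
  then have "D > 0"
    using q unfolding D power2_eq_square by linarith
  then have sD: "sqrt D * sqrt D = D" and sr: "sqrt D * r = 1"
    by (simp_all add: r_def)
  (* The sign 1 yields alpha and its coefficients, the sign -1 yields beta and its coefficients. *)
  define A B where "A \<sigma> = (1 - real q) / 2 + \<sigma> * (sqrt D + 4 * r) / 2"
    and "B \<sigma> = (real q - 2) / 2 - \<sigma> * (sqrt D + (5 - real q) * r) / 2" for \<sigma> :: real
  define \<rho> where "\<rho> \<sigma> = ((real q - 1) + \<sigma> * sqrt D) / 2" for \<sigma> :: real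
  have eig: "A \<sigma> * \<rho> \<sigma> = 2 * A \<sigma> + 2 * B \<sigma>"
      "B \<sigma> * \<rho> \<sigma> = (real q - 4) * A \<sigma> + (real q - 3) * B \<sigma>"
    if "\<sigma> * \<sigma> = 1" for \<sigma>
  proof -
    have sD': "sqrt D * sqrt D = real q * real q - 2 * real q - 7"
      using sD D by (simp add: power2_eq_square)
    show "A \<sigma> * \<rho> \<sigma> = 2 * A \<sigma> + 2 * B \<sigma>"
      "B \<sigma> * \<rho> \<sigma> = (real q - 4) * A \<sigma> + (real q - 3) * B \<sigma>"
      unfolding A_def B_def \<rho>_def by (rule coefficients_eigenvector[OF that sD' sr])+
  qed
  have closed: "a_hat q n = A 1 * \<rho> 1 ^ n + A (-1) * \<rho> (-1) ^ n + 2 \<and>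
      b_hat q n = B 1 * \<rho> 1 ^ n + B (-1) * \<rho> (-1) ^ n - 2" if "n \<ge> 1" for n
    using that
  proof (induction n rule: nat_induct_at_least)
    case base
    have "A 1 * \<rho> 1 + A (-1) * \<rho> (-1) + 2 = 0" "B 1 * \<rho> 1 + B (-1) * \<rho> (-1) - 2 = 0"
      using eig[of 1] eig[of "-1"] by (simp_all add: A_def B_def field_simps)
    then show ?case
      by (simp add: a1[simplified] b1[simplified])
  next
    case (Suc n)
    have "A \<sigma> * \<rho> \<sigma> ^ Suc n = (2 * A \<sigma> + 2 * B \<sigma>) * \<rho> \<sigma> ^ n"
      "B \<sigma> * \<rho> \<sigma> ^ Suc n = ((real q - 4) * A \<sigma> + (real q - 3) * B \<sigma>) * \<rho> \<sigma> ^ n"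
      if "\<sigma> * \<sigma> = 1" for \<sigma>
      using eig[OF that] by (metis mult.assoc power_Suc)+
    then have geo: "A 1 * \<rho> 1 ^ Suc n = (2 * A 1 + 2 * B 1) * \<rho> 1 ^ n"
      "B 1 * \<rho> 1 ^ Suc n = ((real q - 4) * A 1 + (real q - 3) * B 1) * \<rho> 1 ^ n"
      "A (-1) * \<rho> (-1) ^ Suc n = (2 * A (-1) + 2 * B (-1)) * \<rho> (-1) ^ n"
      "B (-1) * \<rho> (-1) ^ Suc n = ((real q - 4) * A (-1) + (real q - 3) * B (-1)) * \<rho> (-1) ^ n"
      by simp_all
    have IH: "a_hat q n = A 1 * \<rho> 1 ^ n + A (-1) * \<rho> (-1) ^ n + 2"
      "b_hat q n = B 1 * \<rho> 1 ^ n + B (-1) * \<rho> (-1) ^ n - 2"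
      using Suc by simp_all
    show ?case
      unfolding geo step[OF Suc.hyps] IH by (simp add: algebra_simps)
  qed
  have \<rho>: "\<rho> 1 = \<alpha>" "\<rho> (-1) = \<beta>"
    by (simp_all add: \<rho>_def \<alpha> \<beta>)
  (* The fractions of the closed forms are rewritten in terms of r, as sqrt D = r * D. *)
  have coeff: "(D + c) / (2 * D) * sqrt D = (sqrt D + c * r) / 2" for c
    using \<open>D > 0\<close> by (simp add: r_def field_simps)
  have coeff': "c / (2 * D) * sqrt D = c * r / 2" for c
    by (simp add: r_def)
  have Dc: "real q ^ 2 - 2 * real q - 3 = D + 4" "real q ^ 2 - 3 * real q - 2 = D + (5 - real q)"
      "real q ^ 2 - 2 * real q - 7 = D"
    by (simp_all add: D)
  have A: "A 1 = (1 - real q) / 2 + (sqrt D + 4 * r) / 2"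
      "A (-1) = (1 - real q) / 2 - (sqrt D + 4 * r) / 2"
    and B: "B 1 = (real q - 2) / 2 - (sqrt D + (5 - real q) * r) / 2"
      "B (-1) = (real q - 2) / 2 + (sqrt D + (5 - real q) * r) / 2"
    by (simp_all add: A_def B_def field_simps)
  have a: "a_hat q n =
         ((1 - real q) / 2
           + (real q ^ 2 - 2 * real q - 3) / (2 * (real q ^ 2 - 2 * real q - 7)) * sqrt D) * \<alpha> ^ n
       + ((1 - real q) / 2
           - (real q ^ 2 - 2 * real q - 3) / (2 * (real q ^ 2 - 2 * real q - 7)) * sqrt D) * \<beta> ^ n
       + 2" if "n \<ge> 1" for n
    unfolding Dc coeff using closed[OF that] by (simp only: A \<rho>)
  have b: "b_hat q n =
         ((real q - 2) / 2
           - (real q ^ 2 - 3 * real q - 2) / (2 * (real q ^ 2 - 2 * real q - 7)) * sqrt D) * \<alpha> ^ n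
       + ((real q - 2) / 2
           + (real q ^ 2 - 3 * real q - 2) / (2 * (real q ^ 2 - 2 * real q - 7)) * sqrt D) * \<beta> ^ n
       - 2" if "n \<ge> 1" for n
    unfolding Dc coeff using closed[OF that] by (simp only: B \<rho>)
  have AB: "A 1 + B 1 = - (1 / 2) + (real q - 1) * r / 2"
      "A (-1) + B (-1) = - (1 / 2) - (real q - 1) * r / 2"
    by (simp_all add: A_def B_def field_simps)
  have s': "s_hat q n =
         (- (1 / 2) + (real q - 1) / (2 * (real q ^ 2 - 2 * real q - 7)) * sqrt D) * \<alpha> ^ n
       + (- (1 / 2) - (real q - 1) / (2 * (real q ^ 2 - 2 * real q - 7)) * sqrt D) * \<beta> ^ n
       + 2" if "n \<ge> 1" for n
    unfolding Dc coeff' AB[symmetric] using closed[OF that] s[OF that]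
    by (simp add: \<rho> algebra_simps)
  show ?thesis
    using rec a1 b1 two three s[of 1] s[of 2] s[of 3] a b s' by auto
qed

end
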